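(* There exist a metric space $Y$ and starting positions in $Y$ for two lions and a man such that, in the game of two lions against a man on $Y$ with these starting positions, the lions do not have a winning strategy and the man does not have a winning strategy.
   Context: Game of two lions against a man on a metric space $Y$ with starting points $x_1,x_2$ (lions) and $y_0$ (man). For $i=1,2$, a path of lion $i$ is a function $l:[0,\infty)\to Y$ with $d(l(s),l(t))\le|s-t|$ for all $s,t$ and $l(0)=x_i$; let $L_i$ be the set of these. A man path is a function $m:[0,\infty)\to Y$ with $d(m(s),m(t))\le|s-t|$ for all $s,t$ and $m(0)=y_0$; let $M$ be the set of these. The two lions form a team, which wins if at least one of the lions catches the man. A strategy for the lions is a function $G:M\to L_1\times L_2$ such that if $m,m'\in M$ agree on $[0,t]$ then $G(m)$ and $G(m')$ agree on $[0,t]$ (in both components); it is winning if for every $m\in M$, writing $G(m)=(l_1,l_2)$, there is $t\ge0$ with $l_1(t)=m(t)$ or $l_2(t)=m(t)$. A strategy for the man is a function $F:L_1\times L_2\to M$ such that if $(l_1,l_2)$ and $(l_1',l_2')$ agree on $[0,t]$ (in both components) then $F(l_1,l_2)$ and $F(l_1',l_2')$ agree on $[0,t]$; it is winning if for all $(l_1,l_2)\in L_1\times L_2$ and all $t\ge0$ we have $F(l_1,l_2)(t)\ne l_1(t)$ and $F(l_1,l_2)(t)\neq l_2(t)$. *)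

theory Defs
  imports "HOL-Analysis.Analysis"
begin

text \<open>
  A path is a function whose domain is exactly the half-line \<open>{0..}\<close>; since HOL functions are
  total, \<open>\<rightarrow>\<^sub>E\<close> makes it \<open>undefined\<close> at negative times.
\<close>

definition paths :: "'a set \<Rightarrow> ('a \<Rightarrow> 'a \<Rightarrow> real) \<Rightarrow> 'a \<Rightarrow> (real \<Rightarrow> 'a) set" where
  "paths Y d x = {p \<in> {0..} \<rightarrow>\<^sub>E Y. (\<forall>s\<ge>0. \<forall>t\<ge>0. d (p s) (p t) \<le> \<bar>s - t\<bar>) \<and> p 0 = x}"

definition agree_upto :: "real \<Rightarrow> (real \<Rightarrow> 'a) \<Rightarrow> (real \<Rightarrow> 'a) \<Rightarrow> bool" where
  "agree_upto t p q \<longleftrightarrow> (\<forall>s\<in>{0..t}. p s = q s)"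

text \<open>
  In the definitions below \<open>x1\<close>, \<open>x2\<close> are the starting points of the lions and \<open>y0\<close> that of the
  man. A strategy is a total HOL function of which only the values on admissible paths matter.
\<close>

definition lions_strategy ::
  "'a set \<Rightarrow> ('a \<Rightarrow> 'a \<Rightarrow> real) \<Rightarrow> 'a \<Rightarrow> 'a \<Rightarrow> 'a
    \<Rightarrow> ((real \<Rightarrow> 'a) \<Rightarrow> (real \<Rightarrow> 'a) \<times> (real \<Rightarrow> 'a)) \<Rightarrow> bool" where
  "lions_strategy Y d x1 x2 y0 G \<longleftrightarrow>
     G \<in> paths Y d y0 \<rightarrow> paths Y d x1 \<times> paths Y d x2 \<and>
     (\<forall>m\<in>paths Y d y0. \<forall>m'\<in>paths Y d y0. \<forall>t\<ge>0.
        agree_upto t m m' \<longrightarrow>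
          agree_upto t (fst (G m)) (fst (G m')) \<and> agree_upto t (snd (G m)) (snd (G m')))"

definition lions_winning_strategy ::
  "'a set \<Rightarrow> ('a \<Rightarrow> 'a \<Rightarrow> real) \<Rightarrow> 'a \<Rightarrow> 'a \<Rightarrow> 'a
    \<Rightarrow> ((real \<Rightarrow> 'a) \<Rightarrow> (real \<Rightarrow> 'a) \<times> (real \<Rightarrow> 'a)) \<Rightarrow> bool" where
  "lions_winning_strategy Y d x1 x2 y0 G \<longleftrightarrow>
     lions_strategy Y d x1 x2 y0 G \<and>
     (\<forall>m\<in>paths Y d y0. \<exists>t\<ge>0. fst (G m) t = m t \<or> snd (G m) t = m t)"

definition man_strategy ::
  "'a set \<Rightarrow> ('a \<Rightarrow> 'a \<Rightarrow> real) \<Rightarrow> 'a \<Rightarrow> 'a \<Rightarrow> 'a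
    \<Rightarrow> ((real \<Rightarrow> 'a) \<times> (real \<Rightarrow> 'a) \<Rightarrow> (real \<Rightarrow> 'a)) \<Rightarrow> bool" where
  "man_strategy Y d x1 x2 y0 F \<longleftrightarrow>
     F \<in> paths Y d x1 \<times> paths Y d x2 \<rightarrow> paths Y d y0 \<and>
     (\<forall>l1\<in>paths Y d x1. \<forall>l2\<in>paths Y d x2. \<forall>l1'\<in>paths Y d x1. \<forall>l2'\<in>paths Y d x2. \<forall>t\<ge>0.
        agree_upto t l1 l1' \<and> agree_upto t l2 l2' \<longrightarrow>
          agree_upto t (F (l1, l2)) (F (l1', l2')))"

definition man_winning_strategy ::
  "'a set \<Rightarrow> ('a \<Rightarrow> 'a \<Rightarrow> real) \<Rightarrow> 'a \<Rightarrow> 'a \<Rightarrow> 'a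
    \<Rightarrow> ((real \<Rightarrow> 'a) \<times> (real \<Rightarrow> 'a) \<Rightarrow> (real \<Rightarrow> 'a)) \<Rightarrow> bool" where
  "man_winning_strategy Y d x1 x2 y0 F \<longleftrightarrow>
     man_strategy Y d x1 x2 y0 F \<and>
     (\<forall>l1\<in>paths Y d x1. \<forall>l2\<in>paths Y d x2. \<forall>t\<ge>0.
        F (l1, l2) t \<noteq> l1 t \<and> F (l1, l2) t \<noteq> l2 t)"

text \<open>
  HOL cannot quantify existentially over types, so an existence statement about metric spaces
  has to draw their points from a fixed type. The type below serves only as a supply of points:
  carrier and metric are arbitrary, so up to isometry one obtains every metric space with at most
  as many points as there are sets of reals.
\<close>

type_synonym point = "(nat \<Rightarrow> real) set"

end

theory Submission
  imports Defs
begin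

text \<open>
  The game is a race in which an earlier decision beats a later one, but no decision is the
  earliest. The space consists of two combs and a ray. Each comb has a trunk along which its runner
  starts at position \<open>0\<close>, and teeth leaving the trunk at forks that accumulate at \<open>0\<close>. All teeth, of
  both combs, end at a common point, the exit, where the ray begins. A tooth at fork \<open>p\<close> has length
  \<open>2 - p / 2\<close>, so whoever runs at full speed and turns at \<open>p\<close> reaches the exit at time
  \<open>2 + p / 2\<close>: the infimum \<open>2\<close> is not attained. The man runs on one comb and the first lion on the
  other; their forks interleave. The second lion starts one unit behind the man, on his comb. If the
  man reaches the exit before the lions, he is safe on the ray. If the first lion is there in time, he
  waits at the exit and the second lion hunts the man down in his comb.

  Given a strategy of the lions, let the man run along his trunk and look at the first lion's answer.
  If at some time \<open>c\<close>, a fork of the man, that lion is not far enough inside a tooth, the man turns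
  into his tooth at \<open>c\<close>; the lions have seen nothing new up to time \<open>c\<close> and are too late. Given a
  strategy of the man, the first lion likewise runs along his trunk and turns at one of his forks at
  which the man is not far enough inside a tooth. In both cases the point is that such a time
  exists: a runner cannot lead at every deadline by dallying, that is, by going into a tooth before
  every deadline and coming back to the trunk afterwards, because the time lost on the excursions adds
  up. This is \<open>no_endless_dallying\<close>, which enters both halves through \<open>exists_missed_deadline\<close>.

  A strategy of the man answers a path of the lions as a whole, so the second lion cannot simply
  react to the man's current position. He moves in steps instead: each time he goes half of the way to
  the man, or less if the man is close to the exit. The man cannot slip past him in so short a time, as
  a comb without the exit is a tree. Since the heights in the comb are bounded, the steps shrink, and in
  the limit the man meets the second lion or the first one at the exit.
\<close>

section \<open>The arena\<close>

text \<open>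
  A site \<open>(k, p, x)\<close> with \<open>k < 2\<close> lies in comb \<open>k\<close>, at height \<open>x\<close> in the tooth at \<open>p\<close>; the sites
  with \<open>x = 0\<close> form the trunk. The man and the second lion live in comb \<open>0\<close>, the first lion in
  comb \<open>1\<close>. The sites \<open>(2, 0, 2 - s)\<close> with \<open>0 \<le> s\<close> form the ray, the exit being \<open>(2, 0, 2)\<close>.
\<close>

type_synonym site = "nat \<times> real \<times> real"

definition forks :: "nat \<Rightarrow> real set" where
  "forks k = range (\<lambda>n. (if k = 0 then 1 else 3 / 4) * (1 / 2) ^ n)"

text \<open>
  The river metric of the plane: one walks along lines orthogonal to the river \<open>x = 0\<close> and along
  the river itself. It is the path metric of a comb, as long as the exit is not used.
\<close>

definition river :: "real \<times> real \<Rightarrow> real \<times> real \<Rightarrow> real" where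
  "river = (\<lambda>(p, x) (q, y). if p = q then \<bar>x - y\<bar> else \<bar>x\<bar> + \<bar>p - q\<bar> + \<bar>y\<bar>)"

text \<open>
  In a tooth and on the ray this is the walking distance to the exit. On the trunk it is only
  a lower bound for it, independent of where the nearest fork is; it keeps \<open>to_exit\<close> Lipschitz for the
  river metric, and a lower bound is all that the race needs there. The absolute value is relevant only outside the arena,
  where distances have to be nonnegative as well. The coordinates of the ray are chosen so that the same
  formula serves there.
\<close>

definition to_exit :: "site \<Rightarrow> real" where
  "to_exit = (\<lambda>(k, p, x). \<bar>2 - p / 2 - x\<bar>)"

definition arena :: "site set" where
  "arena = {(k, p, x). k < 2 \<and> -1 \<le> p \<and> p \<le> 1 \<and> 0 \<le> x \<and> x < 2 - p / 2 \<and> (x = 0 \<or> p \<in> forks k)}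
     \<union> {(k, p, x). k = 2 \<and> p = 0 \<and> x \<le> 2}"

text \<open>
  Gluing at the exit: sites on different pieces are joined only through it, and within one piece the
  detour through the exit may be shorter than the river metric.
\<close>

definition arena_dist :: "site \<Rightarrow> site \<Rightarrow> real" where
  "arena_dist a b =
     (if fst a = fst b then min (river (snd a) (snd b)) (to_exit a + to_exit b)
      else to_exit a + to_exit b)"

lemma river_triangle: "river a c \<le> river a b + river b c"
proof -
  obtain p x q y r z where [simp]: "a = (p, x)" "b = (q, y)" "c = (r, z)"
    by (cases a; cases b; cases c)
  have abs: "\<bar>x - z\<bar> \<le> \<bar>x - y\<bar> + \<bar>y - z\<bar>" "\<bar>p - r\<bar> \<le> \<bar>p - q\<bar> + \<bar>q - r\<bar>"
    "\<bar>x - z\<bar> \<le> \<bar>x\<bar> + \<bar>z\<bar>" "\<bar>x\<bar> \<le> \<bar>x - y\<bar> + \<bar>y\<bar>" "\<bar>z\<bar> \<le> \<bar>y\<bar> + \<bar>y - z\<bar>"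
    by arith+
  have nonneg: "0 \<le> \<bar>y\<bar>" "0 \<le> \<bar>p - q\<bar>" "0 \<le> \<bar>q - r\<bar>"
    by simp_all
  show ?thesis
    by (cases "p = q"; cases "q = r"; cases "p = r"; simp only: river_def prod.case if_True if_False
        \<open>a = (p, x)\<close> \<open>b = (q, y)\<close> \<open>c = (r, z)\<close> refl; use abs nonneg in argo)
qed

lemma to_exit_nonneg: "0 \<le> to_exit a"
  by (cases a) (simp add: to_exit_def)

lemma to_exit_lipschitz_river: "to_exit (k, a) \<le> to_exit (l, b) + river a b"
proof -
  obtain p x q y where [simp]: "a = (p, x)" "b = (q, y)"
    by (cases a; cases b)
  have "\<bar>2 - p / 2 - x\<bar> \<le> \<bar>2 - q / 2 - y\<bar> + (\<bar>p - q\<bar> + \<bar>x - y\<bar>)"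
    by (simp add: abs_if)
  also have "\<bar>p - q\<bar> + \<bar>x - y\<bar> \<le> river a b"
    by (auto simp: river_def)
  finally show ?thesis
    by (simp add: to_exit_def)
qed

lemma to_exit_lipschitz: "to_exit a \<le> to_exit b + arena_dist a b"
  using to_exit_lipschitz_river[of "fst a" "snd a" "fst b" "snd b"] to_exit_nonneg[of b]
  by (auto simp: arena_dist_def)

lemma arena_dist_commute: "arena_dist a b = arena_dist b a"
  by (cases a; cases b) (auto simp: arena_dist_def river_def add_ac abs_minus_commute)

text \<open>
  The triangle inequality survives the gluing because \<open>to_exit\<close> is Lipschitz for the river
  metric.
\<close>

lemma arena_dist_triangle: "arena_dist a c \<le> arena_dist a b + arena_dist b c"
proof -
  have "river (snd a) (snd c) \<le> river (snd a) (snd b) + river (snd b) (snd c)"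
    by (rule river_triangle)
  moreover have "to_exit a \<le> to_exit b + river (snd a) (snd b)"
    "to_exit c \<le> to_exit b + river (snd b) (snd c)"
    using to_exit_lipschitz_river[of "fst a" "snd a" "fst b" "snd b"]
      to_exit_lipschitz_river[of "fst c" "snd c" "fst b" "snd b"]
    by (simp_all add: river_def split_beta abs_minus_commute add_ac split: if_splits)
  ultimately show ?thesis
    using to_exit_nonneg[of a] to_exit_nonneg[of b] to_exit_nonneg[of c]
    unfolding arena_dist_def by (auto simp: min_def)
qed

lemma to_exit_eq_0_iff: "a \<in> arena \<Longrightarrow> to_exit a = 0 \<longleftrightarrow> a = (2, 0, 2)"
  by (cases a) (auto simp: arena_def to_exit_def)

lemma river_nonneg: "0 \<le> river a b"
  by (simp add: river_def split: prod.splits)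

lemma river_eq_0_iff: "river a b = 0 \<longleftrightarrow> a = b"
proof -
  obtain p x q y where [simp]: "a = (p, x)" "b = (q, y)"
    by (cases a; cases b)
  have "\<bar>x\<bar> + \<bar>p - q\<bar> + \<bar>y\<bar> > 0" if "p \<noteq> q"
    using that abs_ge_zero[of x] abs_ge_zero[of y] by (simp add: add_nonneg_pos add_pos_nonneg)
  then show ?thesis
    by (auto simp: river_def)
qed

lemma arena_dist_eq_0_iff:
  assumes "a \<in> arena" "b \<in> arena"
  shows "arena_dist a b = 0 \<longleftrightarrow> a = b"
  using to_exit_eq_0_iff[OF assms(1)] to_exit_eq_0_iff[OF assms(2)] to_exit_nonneg[of a] to_exit_nonneg[of b]
    river_eq_0_iff[of "snd a" "snd b"] river_nonneg[of "snd a" "snd b"]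
  by (auto simp: arena_dist_def min_def prod_eq_iff add_nonneg_eq_0_iff split: if_splits)

lemma Metric_space_arena: "Metric_space arena arena_dist"
proof
  show "0 \<le> arena_dist a b" for a b
    using to_exit_nonneg[of a] to_exit_nonneg[of b] by (auto simp: arena_dist_def river_nonneg)
qed (auto simp: arena_dist_eq_0_iff arena_dist_commute arena_dist_triangle)

text \<open>
  Walking up a tooth and beyond its top leads onto the ray. Parametrizing a tooth together with the ray
  as one long line turns a path up a tooth into a curve in the river metric, followed by the
  nonexpansive map \<open>place k\<close>.
\<close>

definition place :: "nat \<Rightarrow> real \<times> real \<Rightarrow> site" where
  "place k a = (if snd a < 2 - fst a / 2 then (k, a) else (2, 0, 4 - fst a / 2 - snd a))"

definition legal :: "nat \<Rightarrow> real \<times> real \<Rightarrow> bool" where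
  "legal k a \<longleftrightarrow> -1 \<le> fst a \<and> fst a \<le> 1 \<and> 0 \<le> snd a \<and> (snd a = 0 \<or> fst a \<in> forks k)"

lemma place_in_arena: "k < 2 \<Longrightarrow> legal k a \<Longrightarrow> place k a \<in> arena"
  by (cases a) (auto simp: place_def arena_def legal_def)

lemma arena_dist_place:
  assumes "k < 2"
  shows "arena_dist (place k a) (place k b) \<le> river a b"
proof -
  obtain p x q y where ab: "a = (p, x)" "b = (q, y)"
    by (cases a; cases b)
  define u v where "u = 2 - p / 2 - x" and "v = 2 - q / 2 - y"
  have "\<bar>u - v\<bar> \<le> \<bar>p - q\<bar> + \<bar>x - y\<bar>"
    unfolding u_def v_def by (simp add: abs_if)
  also have "\<dots> \<le> river a b"
    by (auto simp: river_def ab)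
  finally have uv: "\<bar>u - v\<bar> \<le> river a b" .
  have exit: "to_exit (place k a) = \<bar>u\<bar>" "to_exit (place k b) = \<bar>v\<bar>"
    by (simp_all add: ab place_def to_exit_def u_def v_def)
  have side: "place k a = (k, a) \<and> 0 < u \<or> place k a = (2, 0, 2 + u) \<and> u \<le> 0"
    "place k b = (k, b) \<and> 0 < v \<or> place k b = (2, 0, 2 + v) \<and> v \<le> 0"
    by (auto simp: ab place_def u_def v_def)
  show ?thesis
  proof (cases "0 < u \<longleftrightarrow> 0 < v")
    case True
    with side have "fst (place k a) = fst (place k b)"
        "river (snd (place k a)) (snd (place k b)) \<le> river a b"
      using uv by (auto simp: river_def)
    then show ?thesis
      by (simp add: arena_dist_def)
  next
    case False
    with side have "fst (place k a) \<noteq> fst (place k b)"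
      using assms by auto
    then have "arena_dist (place k a) (place k b) = \<bar>u\<bar> + \<bar>v\<bar>"
      by (simp add: arena_dist_def exit)
    also have "\<dots> = \<bar>u - v\<bar>"
      using False by (auto simp: abs_if)
    finally show ?thesis using uv by simp
  qed
qed

abbreviation arena_paths :: "site \<Rightarrow> (real \<Rightarrow> site) set" where
  "arena_paths \<equiv> paths arena arena_dist"

lemma restrict_in_paths:
  assumes "\<And>t. 0 \<le> t \<Longrightarrow> g t \<in> Y" "\<And>s t. 0 \<le> s \<Longrightarrow> 0 \<le> t \<Longrightarrow> d (g s) (g t) \<le> \<bar>s - t\<bar>" "g 0 = x"
  shows "restrict g {0..} \<in> paths Y d x"
  using assms by (auto simp: paths_def)

lemma pathsD:
  assumes "m \<in> paths Y d x"
  shows "0 \<le> t \<Longrightarrow> m t \<in> Y" "0 \<le> s \<Longrightarrow> 0 \<le> t \<Longrightarrow> d (m s) (m t) \<le> \<bar>s - t\<bar>" "m 0 = x"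
  using assms by (auto simp: paths_def)

section \<open>Nobody can lead the race at every deadline\<close>

text \<open>
  The deadlines \<open>t i\<close> halve at each step, and at each of them the runner is at height \<open>x i\<close> in the
  tooth at \<open>p i\<close>. Let \<open>e i = t i - p i\<close> be his lateness. Leading means \<open>x i \<ge> e i / 2\<close>. Changing the
  tooth between two deadlines costs the way down and up, which makes the lateness grow by a factor of
  \<open>3\<close>, while there is not enough time for a lateness above \<open>3/4\<close> of the deadline. Three changes in a
  row exceed this, since the lateness is at least a quarter of the deadline. One change
  forces an infinite sequence of changes at all earlier deadlines, so there is none at all; but then the runner
  sits in one tooth at all deadlines, although the deadlines tend to \<open>0\<close>.
\<close>

lemma no_endless_dallying:
  fixes p x t :: "nat \<Rightarrow> real"
  assumes halve: "\<And>i. t (Suc i) = t i / 2"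
    and p_pos: "\<And>i. 0 < p i"
    and gap: "\<And>i. t i / 4 \<le> t i - p i"
    and lead: "\<And>i. (t i - p i) / 2 \<le> x i"
    and speed: "\<And>i. p (Suc i) = p i \<or> x i + x (Suc i) + \<bar>p i - p (Suc i)\<bar> \<le> t i - t (Suc i)"
  shows False
proof -
  have t_eq: "t i = t 0 * (1 / 2) ^ i" for i
    by (induction i) (simp_all add: halve)
  have p_le: "p i \<le> t i" and t_pos: "0 < t i" for i
    using gap[of i] p_pos[of i] by argo+
  have step: "x i + x (Suc i) + \<bar>p i - p (Suc i)\<bar> \<le> t i - t (Suc i)" if "p (Suc i) \<noteq> p i" for i
    using that speed[of i] by blast
  have climb: "3 * (t (Suc i) - p (Suc i)) \<le> t i - p i"
      "3 * (t i - p i) \<le> 4 * (t i - t (Suc i)) + (t (Suc i) - p (Suc i))" if "p (Suc i) \<noteq> p i" for i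
    using step[OF that] lead[of i] lead[of "Suc i"] abs_ge_self[of "p i - p (Suc i)"]
      abs_ge_minus_self[of "p i - p (Suc i)"]
    by argo+
  \<comment> \<open>Staying in a tooth for a whole period makes the runner too late for the next change.\<close>
  have switch: "p (Suc (Suc j)) \<noteq> p (Suc j)" if "p (Suc j) \<noteq> p j" for j
  proof
    assume "p (Suc (Suc j)) = p (Suc j)"
    then show False
      using climb[OF that] halve[of j] halve[of "Suc j"]
        gap[of "Suc (Suc j)"] t_pos[of j]
      by argo
  qed
  obtain j where j: "p (Suc j) \<noteq> p j"
  proof -
    have "\<exists>j. p (Suc j) \<noteq> p j"
    proof (rule ccontr)
      assume "\<nexists>j. p (Suc j) \<noteq> p j"
      then have const: "p i = p 0" for i
        by (induction i) auto
      have "(\<lambda>i. t 0 * (1 / 2) ^ i) \<longlonglongrightarrow> t 0 * 0"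
        by (intro tendsto_intros) auto
      then have "p 0 \<le> t 0 * 0"
        by (rule LIMSEQ_le_const) (use p_le t_eq const in metis)
      with p_pos[of 0] show False by simp
    qed
    then show thesis using that by blast
  qed
  note s = j switch[OF j] switch[OF switch[OF j]]
  from climb[OF s(1)] climb[OF s(2)] climb[OF s(3)] show False
    using gap[of "Suc (Suc (Suc j))"] halve[of j] halve[of "Suc j"] halve[of "Suc (Suc j)"] t_pos[of j]
    by argo
qed

text \<open>
  Before time \<open>1\<close> the exit is too far away to matter, so a runner is still in his own comb and obeys
  the river metric.
\<close>

lemma early_position:
  assumes m: "m \<in> arena_paths (k, 0, 0)" and k: "k < 2" and t: "0 \<le> t" "t \<le> 1"
  obtains p x where "m t = (k, p, x)" "\<bar>p\<bar> + x \<le> t" "0 \<le> x" "x = 0 \<or> p \<in> forks k"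
proof -
  obtain l p x where eq: "m t = (l, p, x)" by (cases "m t")
  have "arena_dist (k, 0, 0) (l, p, x) \<le> t" "(l, p, x) \<in> arena"
    using pathsD[OF m] t eq by (metis abs_minus_commute abs_of_nonneg diff_zero order_refl)+
  then have "l = k \<and> \<bar>p\<bar> + x \<le> t \<and> 0 \<le> x \<and> (x = 0 \<or> p \<in> forks k)"
    using t k by (auto simp: arena_def arena_dist_def to_exit_def river_def min_def split: if_splits)
  then show thesis using that eq by blast
qed

lemma early_speed:
  assumes "arena_dist (k, p, x) (k, q, y) \<le> s" "s \<le> 1" "\<bar>p\<bar> + x \<le> 1" "\<bar>q\<bar> + y \<le> 1" "0 \<le> x" "0 \<le> y"
  shows "river (p, x) (q, y) \<le> s"
  using assms by (auto simp: arena_dist_def to_exit_def min_def split: if_splits)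

text \<open>
  The times that matter for the runner in comb \<open>k\<close>: his opponent, running at full speed, is then at
  one of the forks of the other comb.
\<close>

definition deadline :: "nat \<Rightarrow> nat \<Rightarrow> real" where
  "deadline k i = (if k = 0 then 3 / 4 else 1 / 2) * (1 / 2) ^ i"

lemma fork_gap:
  assumes "p \<in> forks k" "k < 2"
  shows "p \<le> 3 / 4 * deadline k i \<or> 5 / 4 * deadline k i \<le> p"
proof -
  from assms obtain n where n: "p = (if k = 0 then 1 else 3 / 4) * (1 / 2) ^ n"
    by (auto simp: forks_def)
  have "(1 / 2 :: real) ^ n \<le> (1 / 2) ^ i / 2 \<or> (1 / 2 :: real) ^ n = (1/2)^i \<or> 2 * (1 / 2) ^ i \<le> (1 / 2 :: real) ^ n"
  proof -
    consider "Suc i \<le> n" | "n = i" | "Suc n \<le> i" by linarith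
    then show ?thesis
    proof cases
      case 1
      from power_decreasing[OF this, of "1 / 2 :: real"] show ?thesis by simp
    next
      case 3
      from power_decreasing[OF this, of "1 / 2 :: real"] show ?thesis by simp
    qed simp
  qed
  moreover have "(0::real) < (1 / 2) ^ i" by simp
  ultimately show ?thesis
    unfolding n deadline_def by auto
qed

lemma deadline_pos: "0 < deadline k i"
  by (simp add: deadline_def)

lemma deadline_le: "deadline k i \<le> 3 / 4"
  using power_le_one[of "1 / 2 :: real" i] by (simp add: deadline_def)

lemma deadline_Suc: "deadline k (Suc i) = deadline k i / 2"
  by (simp add: deadline_def)

lemma deadline_fork: "k < 2 \<Longrightarrow> deadline k i \<in> forks (1 - k)"
  unfolding forks_def deadline_def
  by (rule range_eqI[of _ _ "if k = 0 then i else Suc i"]) auto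

text \<open>
  Turning at the fork \<open>t\<close>, the opponent arrives at time \<open>2 + t / 2\<close>. A runner at \<open>(k, p, x)\<close> at time
  \<open>t\<close> arrives at time \<open>t + 2 - p / 2 - x\<close> at the earliest, so he is ahead only if
  \<open>x > (t - p) / 2\<close>. The conclusion excludes also equality, except on the trunk.
\<close>

lemma exists_missed_deadline:
  assumes m: "m \<in> arena_paths (k, 0, 0)" and k: "k < 2"
  obtains i p x where "m (deadline k i) = (k, p, x)" "\<bar>p\<bar> + x \<le> deadline k i"
    "x = 0 \<or> x < (deadline k i - p) / 2"
proof (rule ccontr)
  assume no: "\<not> thesis"
  have "\<exists>p x. m (deadline k i) = (k, p, x) \<and> \<bar>p\<bar> + x \<le> deadline k i \<and> 0 < x \<and>
      p \<in> forks k \<and> (deadline k i - p) / 2 \<le> x" for i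
  proof -
    have "0 \<le> deadline k i" "deadline k i \<le> 1"
      using deadline_pos[of k i] deadline_le[of k i] by simp_all
    then obtain p x where px: "m (deadline k i) = (k, p, x)" "\<bar>p\<bar> + x \<le> deadline k i" "0 \<le> x"
        "x = 0 \<or> p \<in> forks k"
      using early_position[OF m k] by blast
    have "\<not> (x = 0 \<or> x < (deadline k i - p) / 2)"
      using no that[OF px(1,2)] by blast
    with px show ?thesis by auto
  qed
  then obtain p x where px: "\<And>i. m (deadline k i) = (k, p i, x i)" "\<And>i. \<bar>p i\<bar> + x i \<le> deadline k i"
      "\<And>i. 0 < x i" "\<And>i. p i \<in> forks k" "\<And>i. (deadline k i - p i) / 2 \<le> x i"
    by metis
  show False
  proof (rule no_endless_dallying[of "deadline k" p x])
    show pos: "0 < p i" for i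
      using px(4)[of i] by (auto simp: forks_def)
    show "deadline k i / 4 \<le> deadline k i - p i" for i
    proof -
      have "p i \<le> deadline k i"
        using px(2)[of i] px(3)[of i] pos[of i] by simp
      then show ?thesis
        using fork_gap[OF px(4) k, of i i] deadline_pos[of k i] by auto
    qed
    show "p (Suc i) = p i \<or> x i + x (Suc i) + \<bar>p i - p (Suc i)\<bar> \<le> deadline k i - deadline k (Suc i)" for i
    proof -
      have "arena_dist (k, p i, x i) (k, p (Suc i), x (Suc i)) \<le> \<bar>deadline k i - deadline k (Suc i)\<bar>"
        using pathsD(2)[OF m, of "deadline k i" "deadline k (Suc i)"] px(1) deadline_pos less_imp_le by metis
      then have "river (p i, x i) (p (Suc i), x (Suc i)) \<le> \<bar>deadline k i - deadline k (Suc i)\<bar>"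
        using px(2)[of i] px(2)[of "Suc i"] px(3)[of i] px(3)[of "Suc i"] deadline_le[of k i] deadline_pos[of k i]
        by (intro early_speed) (auto simp: deadline_Suc)
      then show ?thesis
        using px(3)[of i] px(3)[of "Suc i"] deadline_pos[of k i]
        by (auto simp: river_def deadline_Suc split: if_splits)
    qed
  qed (use px deadline_Suc in auto)
qed

section \<open>The man beats every strategy of the lions\<close>

definition run :: "nat \<Rightarrow> real \<Rightarrow> site" where
  "run k = restrict (\<lambda>t. (k, min t 1, 0)) {0..}"

lemma run_in_paths: "k < 2 \<Longrightarrow> run k \<in> arena_paths (k, 0, 0)"
  unfolding run_def
  by (rule restrict_in_paths) (auto simp: arena_def arena_dist_def river_def min_def)

text \<open>
  Run to the fork \<open>c\<close>, up its tooth, and off along the ray.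
\<close>

definition sprint :: "real \<Rightarrow> real \<Rightarrow> site" where
  "sprint c = restrict (\<lambda>t. place 0 (min t c, max 0 (t - c))) {0..}"

lemma sprint_in_paths:
  assumes "0 < c" "c \<le> 1" "c \<in> forks 0"
  shows "sprint c \<in> arena_paths (0, 0, 0)"
  unfolding sprint_def
proof (rule restrict_in_paths)
  fix s t :: real assume "0 \<le> s" "0 \<le> t"
  show "place 0 (min t c, max 0 (t - c)) \<in> arena"
    using assms \<open>0 \<le> t\<close> by (intro place_in_arena) (auto simp: legal_def min_def max_def)
  have "arena_dist (place 0 (min s c, max 0 (s - c))) (place 0 (min t c, max 0 (t - c)))
      \<le> river (min s c, max 0 (s - c)) (min t c, max 0 (t - c))"
    by (rule arena_dist_place) simp
  also have "\<dots> \<le> \<bar>s - t\<bar>"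
    by (auto simp: river_def min_def max_def)
  finally show "arena_dist (place 0 (min s c, max 0 (s - c))) (place 0 (min t c, max 0 (t - c))) \<le> \<bar>s - t\<bar>" .
qed (use assms in \<open>auto simp: place_def\<close>)

lemma sprint_eq:
  assumes "0 < c" "c \<le> 1" "0 \<le> u"
  shows "u \<le> c \<Longrightarrow> sprint c u = (0, u, 0)"
    "c \<le> u \<Longrightarrow> u < 2 + c / 2 \<Longrightarrow> sprint c u = (0, c, u - c)"
    "2 + c / 2 \<le> u \<Longrightarrow> sprint c u = (2, 0, 4 + c / 2 - u)"
  using assms by (auto simp: sprint_def place_def)

text \<open>
  The second lion is one unit behind when the man turns, and he is further than \<open>2 + c / 2\<close> away from
  the exit.
\<close>

lemma pursuer_from_behind_never_catches:
  assumes l: "l \<in> arena_paths (0, -1, 0)" and c: "0 < c" "c < 1" and u: "0 \<le> u"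
  shows "l u \<noteq> sprint c u"
proof
  assume eq: "l u = sprint c u"
  have "arena_dist (0, -1, 0) (l u) \<le> u"
    using pathsD(2)[OF l, of 0 u] pathsD(3)[OF l] u by simp
  then have d: "arena_dist (0, -1, 0) (sprint c u) \<le> u"
    by (simp add: eq)
  have start: "to_exit (0, -1, 0) = 5 / 2"
    by (simp add: to_exit_def)
  consider "u \<le> c" | "c < u" "u < 2 + c / 2" | "2 + c / 2 \<le> u" by linarith
  then show False
  proof cases
    case 1
    then have "sprint c u = (0, u, 0)" "to_exit (0, u, 0) = 2 - u / 2"
      using c u by (simp_all add: sprint_eq to_exit_def)
    moreover have "river (-1, 0) (u, 0) = 1 + u"
      using u by (simp add: river_def)
    ultimately show False
      using d start c 1 by (simp add: arena_dist_def min_le_iff_disj)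
  next
    case 2
    then have "sprint c u = (0, c, u - c)" "to_exit (0, c, u - c) = 2 + c / 2 - u"
      using c u by (simp_all add: sprint_eq to_exit_def)
    moreover have "river (-1, 0) (c, u - c) = 1 + u"
      using c 2 by (simp add: river_def)
    ultimately show False
      using d start c 2 by (simp add: arena_dist_def min_le_iff_disj)
  next
    case 3
    then have "sprint c u = (2, 0, 4 + c / 2 - u)" "to_exit (2, 0, 4 + c / 2 - u) = u - 2 - c / 2"
      using c u by (simp_all add: sprint_eq to_exit_def)
    then show False
      using d start c by (simp add: arena_dist_def)
  qed
qed

text \<open>
  A lion coming from the other comb has to pass the exit, and from the time when the man is there he
  only escapes further. So a lion who catches him must be able to reach the exit by the
  time \<open>2 + c / 2\<close>.
\<close>

lemma catching_sprint_needs_lead: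
  assumes l: "l \<in> arena_paths (1, 0, 0)" and c: "0 < c" "c < 1"
    and u: "0 \<le> u" "l u = sprint c u" and t: "0 \<le> t" "t \<le> 1"
  shows "to_exit (l t) \<le> 2 + c / 2 - t"
proof -
  have d: "arena_dist (1, 0, 0) (sprint c u) \<le> u"
    using pathsD(2)[OF l, of 0 u] pathsD(3)[OF l] u by simp
  have start: "to_exit (1, 0, 0) = 2"
    by (simp add: to_exit_def)
  have "c < u"
  proof (rule ccontr)
    assume "\<not> c < u"
    then have "sprint c u = (0, u, 0)"
      using c u by (simp add: sprint_eq)
    with d start to_exit_nonneg[of "(0, u, 0)"] \<open>\<not> c < u\<close> c show False
      by (simp add: arena_dist_def)
  qed
  have side: "fst (sprint c u) \<noteq> 1" and exit: "to_exit (sprint c u) = \<bar>2 + c / 2 - u\<bar>"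
    using c u \<open>c < u\<close> by (cases "u < 2 + c / 2"; simp add: sprint_eq to_exit_def)+
  have "t \<le> u"
    using d start side exit t c by (simp add: arena_dist_def)
  obtain p x where lt: "l t = (1, p, x)"
    by (rule early_position[OF l _ t]) auto
  have "arena_dist (l t) (sprint c u) \<le> \<bar>t - u\<bar>"
    using pathsD(2)[OF l, of t u] u t by simp
  then show ?thesis
    using side exit \<open>t \<le> u\<close> by (simp add: arena_dist_def lt)
qed

lemma lions_have_no_winning_strategy:
  "\<not> lions_winning_strategy arena arena_dist (1, 0, 0) (0, -1, 0) (0, 0, 0) G"
proof
  assume win: "lions_winning_strategy arena arena_dist (1, 0, 0) (0, -1, 0) (0, 0, 0) G"
  then have G: "G m \<in> arena_paths (1, 0, 0) \<times> arena_paths (0, -1, 0)"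
      "\<exists>u\<ge>0. fst (G m) u = m u \<or> snd (G m) u = m u" if "m \<in> arena_paths (0, 0, 0)" for m
    using that by (auto simp: lions_winning_strategy_def lions_strategy_def Pi_iff)
  have run: "run 0 \<in> arena_paths (0, 0, 0)" by (simp add: run_in_paths)
  obtain i p x where miss: "fst (G (run 0)) (deadline 1 i) = (1, p, x)" "\<bar>p\<bar> + x \<le> deadline 1 i"
      "x = 0 \<or> x < (deadline 1 i - p) / 2"
    using exists_missed_deadline[of "fst (G (run 0))" 1] G(1)[OF run] by (auto simp: mem_Times_iff)
  define c where "c = deadline 1 i"
  have c: "0 < c" "c < 1" "c \<in> forks 0"
    using deadline_pos[of 1 i] deadline_le[of 1 i] deadline_fork[of 1 i] by (auto simp: c_def)
  define l where "l = fst (G (sprint c))"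
  have sprint: "sprint c \<in> arena_paths (0, 0, 0)"
    using c by (simp add: sprint_in_paths)
  have l: "l \<in> arena_paths (1, 0, 0)" "snd (G (sprint c)) \<in> arena_paths (0, -1, 0)"
    using G(1)[OF sprint] by (auto simp: l_def mem_Times_iff)
  have "agree_upto c (run 0) (sprint c)"
    using c by (auto simp: agree_upto_def run_def sprint_eq)
  then have "agree_upto c (fst (G (run 0))) l"
    using win run sprint c unfolding l_def lions_winning_strategy_def lions_strategy_def by auto
  then have lc: "l c = (1, p, x)"
    using miss(1) c by (auto simp: agree_upto_def c_def)
  obtain u where u: "0 \<le> u" "l u = sprint c u"
    using G(2)[OF sprint] pursuer_from_behind_never_catches[OF l(2) c(1,2)] by (auto simp: l_def)
  note lead = catching_sprint_needs_lead[OF l(1) c(1,2) u]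
  \<comment> \<open>The lion has not missed the deadline by a positive amount, so only a tie on the trunk is left.\<close>
  have "2 - p / 2 - x \<le> 2 - c / 2"
    using lead[of c] c lc by (auto simp: to_exit_def)
  with miss have "x = 0" "p = c"
    by (auto simp: c_def)
  \<comment> \<open>In a tie the lion stands on his trunk at \<open>c\<close>, with no fork of his own closer than \<open>c / 4\<close>. A moment later
    he is still on the trunk, and \<open>to_exit\<close> decreases there only at half his speed.\<close>
  define s where "s = c + c / 5"
  have s: "0 \<le> s" "s \<le> 1"
    using c deadline_le[of 1 i] by (auto simp: s_def c_def)
  obtain q y where qy: "l s = (1, q, y)" "\<bar>q\<bar> + y \<le> s" "0 \<le> y" "y = 0 \<or> q \<in> forks 1"
    by (rule early_position[OF l(1) _ s]) auto
  have "arena_dist (1, c, 0) (1, q, y) \<le> \<bar>c - s\<bar>"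
    using pathsD(2)[OF l(1), of c s] c s lc qy(1) \<open>x = 0\<close> \<open>p = c\<close> by simp
  then have "river (c, 0) (q, y) \<le> \<bar>c - s\<bar>"
    using c s qy by (intro early_speed) (auto simp: s_def)
  then have near: "\<bar>c - q\<bar> \<le> c / 5"
    using c qy by (auto simp: river_def s_def split: if_splits)
  have "q \<notin> forks 1"
    using fork_gap[of q 1 i] near c by (auto simp: c_def)
  with qy have "y = 0" by simp
  with lead[OF s] qy near c show False
    by (auto simp: to_exit_def s_def)
qed

section \<open>Geodesics from the root of a comb\<close>

text \<open>
  The geodesic to \<open>a\<close> from the far end of the trunk, parametrized by height; it stops at
  \<open>a\<close>.
\<close>

definition route :: "real \<times> real \<Rightarrow> real \<Rightarrow> real \<times> real" where
  "route a r = (min r (fst a), min (snd a) (max 0 (r - fst a)))"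

definition height :: "real \<times> real \<Rightarrow> real" where
  "height a = fst a + snd a"

lemma river_route: "0 \<le> snd a \<Longrightarrow> river (route a r) (route a s) \<le> \<bar>r - s\<bar>"
  by (auto simp: river_def route_def min_def max_def)

lemma route_height: "0 \<le> snd a \<Longrightarrow> route a (height a) = a"
  by (cases a) (auto simp: route_def height_def)

lemma height_route: "0 \<le> snd a \<Longrightarrow> r \<le> height a \<Longrightarrow> height (route a r) = r"
  by (auto simp: route_def height_def min_def max_def)

lemma route_route: "0 \<le> snd a \<Longrightarrow> r \<le> s \<Longrightarrow> route (route a s) r = route a r"
  by (auto simp: route_def min_def max_def)

lemma legal_route: "legal k a \<Longrightarrow> -1 \<le> r \<Longrightarrow> legal k (route a r)"
  by (auto simp: route_def legal_def min_def max_def)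

text \<open>
  In a tree, moving the end point of a geodesic by a distance \<open>e\<close> changes only the last piece of
  length \<open>e\<close>. This is why the man cannot get past a lion who comes at most half of the way towards him.
\<close>

lemma route_shared:
  assumes "river a b \<le> height a - r" "0 \<le> snd a" "0 \<le> snd b"
  shows "route b r = route a r" "r \<le> height b"
proof -
  obtain p x q y where ab: "a = (p, x)" "b = (q, y)"
    by (cases a; cases b)
  have "route b r = route a r \<and> r \<le> height b"
  proof (cases "p = q")
    case True
    then have "\<bar>x - y\<bar> \<le> p + x - r"
      using assms by (simp add: ab river_def height_def)
    then have "r - p \<le> x" "r - p \<le> y" by arith+
    with True assms show ?thesis
      by (simp add: ab route_def height_def)
  next
    case False
    then have "x + \<bar>p - q\<bar> + y \<le> p + x - r"
      using assms by (simp add: ab river_def height_def)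
    then have "r \<le> p" "r \<le> q" "0 \<le> y" using assms(3) ab by auto
    with assms show ?thesis
      by (simp add: ab route_def height_def)
  qed
  then show "route b r = route a r" "r \<le> height b" by blast+
qed

section \<open>The lions beat every strategy of the man\<close>

text \<open>
  Run to the fork \<open>t\<close>, up its tooth, and wait at the exit.
\<close>

definition block :: "real \<Rightarrow> real \<Rightarrow> site" where
  "block t = restrict (\<lambda>u. place 1 (route (t, 2 - t / 2) u)) {0..}"

lemma block_in_paths:
  assumes "0 < t" "t \<le> 1" "t \<in> forks 1"
  shows "block t \<in> arena_paths (1, 0, 0)"
  unfolding block_def
proof (rule restrict_in_paths)
  fix s u :: real assume "0 \<le> s" "0 \<le> u"
  show "place 1 (route (t, 2 - t / 2) u) \<in> arena"
    using assms \<open>0 \<le> u\<close> by (intro place_in_arena legal_route) (auto simp: legal_def)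
  have "arena_dist (place 1 (route (t, 2 - t / 2) s)) (place 1 (route (t, 2 - t / 2) u))
      \<le> river (route (t, 2 - t / 2) s) (route (t, 2 - t / 2) u)"
    by (rule arena_dist_place) simp
  also have "\<dots> \<le> \<bar>s - u\<bar>"
    using assms by (intro river_route) simp
  finally show "arena_dist (place 1 (route (t, 2 - t / 2) s)) (place 1 (route (t, 2 - t / 2) u)) \<le> \<bar>s - u\<bar>" .
qed (use assms in \<open>simp add: place_def route_def\<close>)

lemma block_eq:
  assumes "0 < t" "t \<le> 1"
  shows "0 \<le> u \<Longrightarrow> u \<le> t \<Longrightarrow> block t u = run 1 u"
    "2 + t / 2 \<le> u \<Longrightarrow> block t u = (2, 0, 2)"
  using assms by (simp_all add: block_def run_def place_def route_def)

text \<open>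
  The second lion waits at the root until time \<open>T\<close> and then runs to \<open>z\<close> and stops. The root has height
  \<open>-1\<close>, so he has height \<open>u - T - 1\<close> at time \<open>u\<close> on his way.
\<close>

definition chase :: "real \<Rightarrow> real \<times> real \<Rightarrow> real \<Rightarrow> site" where
  "chase T z = restrict (\<lambda>u. place 0 (route z (max (-1) (u - T - 1)))) {0..}"

lemma chase_in_paths:
  assumes "0 \<le> T" "legal 0 z"
  shows "chase T z \<in> arena_paths (0, -1, 0)"
  unfolding chase_def
proof (rule restrict_in_paths)
  fix s u :: real assume "0 \<le> s" "0 \<le> u"
  let ?g = "\<lambda>u. max (-1) (u - T - 1)"
  show "place 0 (route z (?g u)) \<in> arena"
    using assms by (intro place_in_arena legal_route) auto
  have "arena_dist (place 0 (route z (?g s))) (place 0 (route z (?g u)))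
      \<le> river (route z (?g s)) (route z (?g u))"
    by (rule arena_dist_place) simp
  also have "\<dots> \<le> \<bar>?g s - ?g u\<bar>"
    using assms by (intro river_route) (simp add: legal_def)
  also have "\<dots> \<le> \<bar>s - u\<bar>"
    by (simp add: max_def abs_if)
  finally show "arena_dist (place 0 (route z (?g s))) (place 0 (route z (?g u))) \<le> \<bar>s - u\<bar>" .
qed (use assms in \<open>auto simp: place_def route_def legal_def\<close>)

lemma chase_agree:
  assumes "0 \<le> snd w" "z = route w (height z)" "-1 \<le> height z"
  shows "agree_upto (T + 1 + height z) (chase T z) (chase T w)"
proof (unfold agree_upto_def, intro ballI)
  fix u assume "u \<in> {0..T + 1 + height z}"
  then have "max (-1) (u - T - 1) \<le> height z"
    using assms(3) by simp
  with assms(1,2) have "route z (max (-1) (u - T - 1)) = route w (max (-1) (u - T - 1))"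
    by (metis route_route)
  then show "chase T z u = chase T w u" by (simp add: chase_def)
qed

lemma chase_waits: "legal 0 z \<Longrightarrow> 0 \<le> u \<Longrightarrow> u \<le> T \<Longrightarrow> chase T z u = (0, -1, 0)"
  by (cases z) (auto simp: chase_def route_def place_def legal_def)

lemma chase_end: "0 \<le> T \<Longrightarrow> legal 0 z \<Longrightarrow> chase T z (T + 1 + height z) = place 0 z"
  by (auto simp: chase_def legal_def height_def route_height[unfolded height_def])

lemma arena_side_0:
  assumes "(0, a) \<in> arena"
  shows "legal 0 a" "place 0 a = (0, a)" "snd a \<le> 5 / 2" "0 < to_exit (0, a)"
  using assms by (cases a; auto simp: arena_def legal_def place_def to_exit_def)+

text \<open>
  A growing chain of geodesics from the root has a limit, because the heights are bounded. The limit
  may be the top of a tooth, which is the exit.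
\<close>

lemma nested_routes_converge:
  fixes z :: "nat \<Rightarrow> real \<times> real"
  assumes legal: "\<And>n. legal k (z n)" and bounded: "\<And>n. snd (z n) \<le> B"
    and nested: "\<And>n. z n = route (z (Suc n)) (height (z n))"
  obtains w where "legal k w" "\<And>n. z n = route w (height (z n))" "\<And>n. height (z n) \<le> height w"
    "(\<lambda>n. height (z n)) \<longlonglongrightarrow> height w"
proof -
  have snd_nonneg: "0 \<le> snd (z n)" and fst_le: "fst (z n) \<le> 1" for n
    using legal[of n] by (auto simp: legal_def)
  have mono_Suc: "fst (z n) \<le> fst (z (Suc n))" "snd (z n) \<le> snd (z (Suc n))" for n
    by (subst nested[of n], simp add: route_def)+
  have "incseq (\<lambda>n. fst (z n))" "incseq (\<lambda>n. snd (z n))"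
    using mono_Suc by (auto simp: incseq_Suc_iff)
  note incseq = this
  obtain p where p: "(\<lambda>n. fst (z n)) \<longlonglongrightarrow> p" "\<And>n. fst (z n) \<le> p"
    using incseq_convergent[OF incseq(1)] fst_le by metis
  obtain x where x: "(\<lambda>n. snd (z n)) \<longlonglongrightarrow> x" "\<And>n. snd (z n) \<le> x"
    using incseq_convergent[OF incseq(2)] bounded by metis
  define r where "r n = height (z n)" for n
  have later: "z n = route (z j) (r n)" if "n \<le> j" for n j
    using that
  proof (induction j rule: dec_induct)
    case base
    then show ?case using route_height[OF snd_nonneg] by (simp add: r_def)
  next
    case (step j)
    have "r n \<le> height (z j)"
      using incseq step(1) by (simp add: r_def height_def incseq_def add_mono)
    then have "route (z j) (r n) = route (z (Suc j)) (r n)"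
      using route_route[OF snd_nonneg] nested by metis
    with step show ?case by simp
  qed
  have lim: "z n = route (p, x) (r n)" for n
  proof -
    have limits: "(\<lambda>j. min (r n) (fst (z j))) \<longlonglongrightarrow> min (r n) p"
      "(\<lambda>j. min (snd (z j)) (max 0 (r n - fst (z j)))) \<longlonglongrightarrow> min x (max 0 (r n - p))"
      by (intro tendsto_intros p x)+
    have "min (r n) (fst (z j)) = fst (z n)"
        "min (snd (z j)) (max 0 (r n - fst (z j))) = snd (z n)" if "n \<le> j" for j
      using arg_cong[OF later[OF that], of fst, symmetric] arg_cong[OF later[OF that], of snd, symmetric]
      unfolding route_def fst_conv snd_conv by simp_all
    then have const: "eventually (\<lambda>j. min (r n) (fst (z j)) = fst (z n)) sequentially"
      "eventually (\<lambda>j. min (snd (z j)) (max 0 (r n - fst (z j))) = snd (z n)) sequentially"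
      by (auto simp only: eventually_sequentially)
    have "fst (z n) = min (r n) p"
      by (rule LIMSEQ_unique[OF tendsto_eventually[OF const(1)] limits(1)])
    moreover have "snd (z n) = min x (max 0 (r n - p))"
      by (rule LIMSEQ_unique[OF tendsto_eventually[OF const(2)] limits(2)])
    ultimately show ?thesis by (simp add: route_def prod_eq_iff)
  qed
  have px: "legal k (p, x)"
  proof (cases "x = 0")
    case True
    have "p \<le> 1"
      by (rule LIMSEQ_le_const2[OF p(1)]) (use fst_le in blast)
    with True p(2)[of 0] legal[of 0] show ?thesis by (auto simp: legal_def)
  next
    case False
    have "\<exists>n. snd (z n) \<noteq> 0"
    proof (rule ccontr)
      assume "\<nexists>n. snd (z n) \<noteq> 0"
      then have "(\<lambda>n. snd (z n)) \<longlonglongrightarrow> 0" by simp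
      from LIMSEQ_unique[OF x(1) this] False show False by simp
    qed
    then obtain n where n: "snd (z n) \<noteq> 0" by blast
    moreover have "snd (z n) = min x (max 0 (r n - p))" "fst (z n) = min (r n) p"
      using arg_cong[OF lim[of n], of snd] arg_cong[OF lim[of n], of fst]
      unfolding route_def fst_conv snd_conv by simp_all
    ultimately have "fst (z n) = p"
      using x(2)[of n] legal[of n] by (auto simp: legal_def min_def max_def split: if_splits)
    then show ?thesis
      using legal[of n] n x(2)[of n] by (auto simp: legal_def)
  qed
  have conv: "(\<lambda>n. height (z n)) \<longlonglongrightarrow> height (p, x)"
    unfolding height_def fst_conv snd_conv by (intro tendsto_intros p x)
  have le: "height (z n) \<le> height (p, x)" for n
    using p(2) x(2) by (simp add: height_def add_mono)
  show thesis
    by (rule that[OF px lim[unfolded r_def] le conv])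
qed

lemma man_has_no_winning_strategy:
  "\<not> man_winning_strategy arena arena_dist (1, 0, 0) (0, -1, 0) (0, 0, 0) F"
proof
  assume win: "man_winning_strategy arena arena_dist (1, 0, 0) (0, -1, 0) (0, 0, 0) F"
  let ?L1 = "arena_paths (1, 0, 0)" and ?L2 = "arena_paths (0, -1, 0)"
  have F: "F (l1, l2) \<in> arena_paths (0, 0, 0)" if "l1 \<in> ?L1" "l2 \<in> ?L2" for l1 l2
    using win that by (auto simp: man_winning_strategy_def man_strategy_def)
  have F_free: "F (l1, l2) u \<noteq> l1 u" "F (l1, l2) u \<noteq> l2 u" if "l1 \<in> ?L1" "l2 \<in> ?L2" "0 \<le> u" for l1 l2 u
    using win that by (auto simp: man_winning_strategy_def)
  have F_agree: "F (l1, l2) s = F (l1', l2') s"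
    if "l1 \<in> ?L1" "l2 \<in> ?L2" "l1' \<in> ?L1" "l2' \<in> ?L2" "agree_upto s l1 l1'" "agree_upto s l2 l2'" "0 \<le> s"
    for l1 l2 l1' l2' s
  proof -
    have "agree_upto s (F (l1, l2)) (F (l1', l2'))"
      using win that unfolding man_winning_strategy_def man_strategy_def by blast
    with that show ?thesis by (simp add: agree_upto_def)
  qed
  define z0 :: "real \<times> real" where "z0 = (-1, 0)"
  have z0: "legal 0 z0" "height z0 = -1"
    by (simp_all add: z0_def legal_def height_def)
  define idle where "idle = chase 1 z0"
  have run: "run 1 \<in> ?L1" and idle: "idle \<in> ?L2"
    using z0 by (simp_all add: run_in_paths idle_def chase_in_paths)
  obtain i p x where miss: "F (run 1, idle) (deadline 0 i) = (0, p, x)" "\<bar>p\<bar> + x \<le> deadline 0 i"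
      "x = 0 \<or> x < (deadline 0 i - p) / 2"
    using exists_missed_deadline[OF F[OF run idle]] by auto
  define t where "t = deadline 0 i"
  have t: "0 < t" "t \<le> 3 / 4" "t \<in> forks 1"
    using deadline_pos[of 0 i] deadline_le[of 0 i] deadline_fork[of 0 i] by (auto simp: t_def)
  define T where "T = 2 + t / 2"
  define M where "M z = F (block t, chase T z)" for z
  have block: "block t \<in> ?L1"
    using t by (intro block_in_paths) auto
  have chase: "chase T z \<in> ?L2" if "legal 0 z" for z
    using t that by (simp add: chase_in_paths T_def)
  have M: "M z \<in> arena_paths (0, 0, 0)" if "legal 0 z" for z
    unfolding M_def using F block chase that by blast
  have M_free: "M z u \<noteq> chase T z u" "M z u \<noteq> block t u" if "legal 0 z" "0 \<le> u" for z u
    unfolding M_def using F_free block chase that by blast+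
  have M_agree: "M w (T + 1 + height z) = M z (T + 1 + height z)"
    if "legal 0 z" "legal 0 w" "z = route w (height z)" for z w
    unfolding M_def
  proof (rule F_agree)
    have "-1 \<le> height z" using that(1) by (auto simp: legal_def height_def)
    then show "agree_upto (T + 1 + height z) (chase T w) (chase T z)" "0 \<le> T + 1 + height z"
      using chase_agree[of w z T] that t by (simp_all add: legal_def agree_upto_def T_def)
  qed (use that block chase in \<open>auto simp: agree_upto_def\<close>)
  have M_T: "\<exists>a. M z T = (0, a)" if z: "legal 0 z" for z
  proof (rule ccontr)
    assume no: "\<nexists>a. M z T = (0, a)"
    have "M z t = F (run 1, idle) t"
      unfolding M_def
    proof (rule F_agree)
      show "agree_upto t (block t) (run 1)"
        using t by (simp add: agree_upto_def block_eq)
      show "agree_upto t (chase T z) idle"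
        using t z z0 by (simp add: agree_upto_def idle_def chase_waits T_def)
    qed (use t z block chase run idle in auto)
    then have "M z t = (0, p, x)"
      using miss by (simp add: t_def)
    moreover have "2 - t / 2 \<le> to_exit (0, p, x)"
      using miss(2,3) by (auto simp: to_exit_def t_def)
    moreover have "arena_dist (M z t) (M z T) \<le> 2 - t / 2"
      using pathsD(2)[OF M[OF z], of t T] t by (simp add: T_def)
    moreover have "fst (M z T) \<noteq> 0"
      using no by (metis prod.collapse)
    ultimately have "to_exit (M z T) \<le> 0"
      by (simp add: arena_dist_def)
    then have "M z T = (2, 0, 2)"
      using to_exit_eq_0_iff[of "M z T"] to_exit_nonneg[of "M z T"] pathsD(1)[OF M[OF z], of T] t
      by (simp add: T_def)
    then show False
      using M_free(2)[OF z, of T] block_eq(2)[of t T] t by (simp add: T_def)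
  qed
  \<comment> \<open>At the time when the lion reaches \<open>z\<close>, the man is in his comb and \<open>z\<close> separates him from the root.\<close>
  define good where "good z \<longleftrightarrow> legal 0 z \<and> snd z \<le> 5 / 2 \<and>
    (\<exists>a. M z (T + 1 + height z) = (0, a) \<and> height z \<le> height a \<and> z = route a (height z))" for z
  \<comment> \<open>The lion goes on from \<open>z\<close> to \<open>z'\<close>, covering at least half of his distance to the man or half of the
    man's distance to the exit.\<close>
  define closer where "closer z z' \<longleftrightarrow> z = route z' (height z) \<and>
    min (arena_dist (place 0 z) (M z (T + 1 + height z))) (to_exit (M z (T + 1 + height z)))
      \<le> 2 * (height z' - height z)" for z z'
  have start: "good z0"
  proof -
    obtain a where a: "M z0 T = (0, a)" using M_T z0 by blast
    then have "legal 0 a"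
      using arena_side_0(1) pathsD(1)[OF M[OF z0(1)], of T] t by (simp add: T_def)
    then have "-1 \<le> height a" "route a (-1) = z0"
      by (auto simp: legal_def height_def route_def z0_def)
    with a z0 show ?thesis by (simp add: good_def z0_def)
  qed
  have step: "\<exists>z'. good z' \<and> closer z z'" if good: "good z" for z
  proof -
    from good obtain a where z: "legal 0 z" and a: "M z (T + 1 + height z) = (0, a)"
        "height z \<le> height a" "z = route a (height z)"
      by (auto simp: good_def)
    have height_z: "-1 \<le> height z" using z by (auto simp: legal_def height_def)
    then have time: "0 \<le> T + 1 + height z" using t by (simp add: T_def)
    have "(0, a) \<in> arena"
      using pathsD(1)[OF M[OF z] time] a by simp
    note arena = this arena_side_0[OF this]
    have snd_a: "0 \<le> snd a" using arena by (simp add: legal_def)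
    \<comment> \<open>Within time \<open>h\<close> the man cannot reach the exit, so he moves in the tree; and he cannot get around a
      lion who advances by no more than half of the distance.\<close>
    define h where "h = min (height a - height z) (to_exit (0, a)) / 2"
    define z' where "z' = route a (height z + h)"
    have h: "0 \<le> h" "2 * h \<le> height a - height z" "h < to_exit (0, a)"
      using a arena by (auto simp: h_def)
    have z': "legal 0 z'" "height z' = height z + h" "route z' (height z) = z"
      using arena h height_z a(3) snd_a
      by (simp_all add: z'_def legal_route height_route route_route)
    have "snd z' \<le> snd a" by (simp add: z'_def route_def)
    then have snd_z': "snd z' \<le> 5 / 2" using arena(4) by simp
    have "M z' (T + 1 + height z) = (0, a)"
      using M_agree[OF z z'(1)] z'(3) a by simp
    then have d: "arena_dist (0, a) (M z' (T + 1 + height z')) \<le> h"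
      using pathsD(2)[OF M[OF z'(1)] time, of "T + 1 + height z'"] time h z'(2) by simp
    have "fst (M z' (T + 1 + height z')) = 0"
      using d h to_exit_nonneg[of "M z' (T + 1 + height z')"] by (auto simp: arena_dist_def split: if_splits)
    then obtain b where b: "M z' (T + 1 + height z') = (0, b)"
      by (metis prod.collapse)
    then have "(0, b) \<in> arena"
      using pathsD(1)[OF M[OF z'(1)], of "T + 1 + height z'"] time h z'(2) by simp
    then have snd_b: "0 \<le> snd b" using arena_side_0 by (simp add: legal_def)
    have "river a b \<le> h"
      using d h to_exit_nonneg[of "(0, b)"] by (auto simp: b arena_dist_def min_le_iff_disj)
    then have "river a b \<le> height a - (height z + h)"
      using h by simp
    from route_shared[OF this snd_a snd_b] have "good z'"
      using z' snd_z' b by (simp add: good_def z'_def)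
    moreover have "arena_dist (place 0 z) (0, a) \<le> height a - height z"
    proof -
      have "arena_dist (place 0 z) (0, a) \<le> river z a"
        using arena_dist_place[of 0 z a] arena by simp
      also have "\<dots> = river (route a (height z)) (route a (height a))"
        using a(3) route_height[OF snd_a] by simp
      also have "\<dots> \<le> height a - height z"
        using river_route[OF snd_a, of "height z" "height a"] a(2) by simp
      finally show ?thesis .
    qed
    then have "closer z z'"
      using z'(2,3) a(1) by (auto simp: closer_def h_def min_le_iff_disj)
    ultimately show ?thesis by blast
  qed
  obtain z where z: "\<And>n. good (z n)" "\<And>n. closer (z n) (z (Suc n))"
    using dependent_nat_choice[of "\<lambda>_. good" "\<lambda>_. closer"] start step by metis
  obtain w where w: "legal 0 w" "\<And>n. z n = route w (height (z n))" "\<And>n. height (z n) \<le> height w"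
      "(\<lambda>n. height (z n)) \<longlonglongrightarrow> height w"
    using nested_routes_converge[of 0 z "5 / 2"] z by (auto simp: good_def closer_def)
  define u where "u = T + 1 + height w"
  have u: "T \<le> u" "0 \<le> u"
    using w(1) t by (auto simp: u_def legal_def height_def T_def)
  \<comment> \<open>The gap tends to \<open>0\<close> along the chain, so it is \<open>0\<close> at the limit time \<open>u\<close>: the man is then caught by
    the second lion, or by the first one at the exit.\<close>
  define gap where "gap s = min (arena_dist (chase T w s) (M w s)) (to_exit (M w s))" for s
  have bound: "gap u \<le> 2 * (height (z (Suc n)) - height (z n)) + 2 * (height w - height (z n))" for n
  proof -
    define s where "s = T + 1 + height (z n)"
    have legal_n: "legal 0 (z n)" using z(1) by (simp add: good_def)
    then have s: "0 \<le> s" "s \<le> u"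
      using w(3)[of n] t by (auto simp: s_def u_def legal_def height_def T_def)
    have "chase T w s = place 0 (z n)"
      using chase_agree[of w "z n" T] chase_end[of T "z n"] legal_n w(1,2) s t
      by (auto simp: agree_upto_def s_def legal_def height_def T_def)
    moreover have "M w s = M (z n) s"
      unfolding s_def using M_agree legal_n w by blast
    ultimately have "gap s \<le> 2 * (height (z (Suc n)) - height (z n))"
      using z(2)[of n] by (simp add: closer_def gap_def s_def)
    moreover have "gap u \<le> gap s + 2 * (u - s)"
    proof -
      have c: "arena_dist (chase T w u) (chase T w s) \<le> u - s"
        using pathsD(2)[OF chase[OF w(1)] u(2) s(1)] s by simp
      have m: "arena_dist (M w u) (M w s) \<le> u - s"
        using pathsD(2)[OF M[OF w(1)] u(2) s(1)] s by simp
      have "arena_dist (chase T w u) (M w u) \<le> arena_dist (chase T w s) (M w s) + 2 * (u - s)"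
        using c m arena_dist_triangle[of "chase T w u" "M w u" "chase T w s"]
          arena_dist_triangle[of "chase T w s" "M w u" "M w s"] arena_dist_commute[of "M w u" "M w s"]
        by simp
      moreover have "to_exit (M w u) \<le> to_exit (M w s) + 2 * (u - s)"
        using to_exit_lipschitz[of "M w u" "M w s"] m s by simp
      ultimately show ?thesis by (auto simp: gap_def min_def)
    qed
    ultimately show ?thesis by (simp add: s_def u_def)
  qed
  have "(\<lambda>n. 2 * (height (z (Suc n)) - height (z n)) + 2 * (height w - height (z n)))
      \<longlonglongrightarrow> 2 * (height w - height w) + 2 * (height w - height w)"
    by (intro tendsto_intros w(4) LIMSEQ_Suc)
  then have "gap u \<le> 2 * (height w - height w) + 2 * (height w - height w)"
    by (rule LIMSEQ_le_const) (use bound in blast)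
  then consider "arena_dist (chase T w u) (M w u) \<le> 0" | "to_exit (M w u) \<le> 0"
    by (auto simp: gap_def min_le_iff_disj)
  then show False
  proof cases
    case 1
    then have "arena_dist (chase T w u) (M w u) = 0"
      using Metric_space.nonneg[OF Metric_space_arena, of "chase T w u" "M w u"] by simp
    then have "M w u = chase T w u"
      using arena_dist_eq_0_iff pathsD(1)[OF chase[OF w(1)] u(2)] pathsD(1)[OF M[OF w(1)] u(2)] by metis
    with M_free(1)[OF w(1) u(2)] show False by simp
  next
    case 2
    then have "M w u = (2, 0, 2)"
      using to_exit_eq_0_iff pathsD(1)[OF M[OF w(1)] u(2)] to_exit_nonneg[of "M w u"] by simp
    with M_free(2)[OF w(1) u(2)] show False
      using block_eq(2)[of t u] u t by (simp add: T_def)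
  qed
qed

section \<open>Relabelling the points of a game\<close>

text \<open>
  The arena consists of triples of numbers. The game is carried over to other points along an
  injection \<open>f\<close>; \<open>relabel\<close> restricts to nonnegative times, as paths are undefined elsewhere.
\<close>

definition relabel :: "('a \<Rightarrow> 'b) \<Rightarrow> (real \<Rightarrow> 'a) \<Rightarrow> real \<Rightarrow> 'b" where
  "relabel g p = restrict (g \<circ> p) {0..}"

definition pull_dist :: "('a \<Rightarrow> 'b) \<Rightarrow> ('a \<Rightarrow> 'a \<Rightarrow> real) \<Rightarrow> 'b \<Rightarrow> 'b \<Rightarrow> real" where
  "pull_dist f d u v = d (inv f u) (inv f v)"

lemma relabel_in_paths:
  assumes "inj f" "p \<in> paths Y d x"
  shows "relabel f p \<in> paths (f ` Y) (pull_dist f d) (f x)"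
  using assms unfolding relabel_def
  by (intro restrict_in_paths) (auto simp: pull_dist_def dest: pathsD)

lemma relabel_inv_in_paths:
  assumes "inj f" "q \<in> paths (f ` Y) (pull_dist f d) (f x)"
  shows "relabel (inv f) q \<in> paths Y d x"
  unfolding relabel_def
proof (rule restrict_in_paths)
  fix s t :: real assume st: "0 \<le> s" "0 \<le> t"
  show "(inv f \<circ> q) t \<in> Y"
    using pathsD(1)[OF assms(2) st(2)] assms(1) by auto
  show "d ((inv f \<circ> q) s) ((inv f \<circ> q) t) \<le> \<bar>s - t\<bar>"
    using pathsD(2)[OF assms(2) st] by (simp add: pull_dist_def)
qed (use pathsD(3)[OF assms(2)] assms(1) in simp)

lemma relabel_agree: "agree_upto t p q \<Longrightarrow> agree_upto t (relabel g p) (relabel g q)"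
  by (simp add: agree_upto_def relabel_def)

lemma relabel_apply: "0 \<le> t \<Longrightarrow> relabel g p t = g (p t)"
  by (simp add: relabel_def)

lemma Metric_space_relabel:
  assumes "inj f" "Metric_space Y d"
  shows "Metric_space (f ` Y) (pull_dist f d)"
proof -
  interpret Metric_space Y d by (rule assms(2))
  show ?thesis
    by unfold_locales (use assms(1) in \<open>auto simp: pull_dist_def commute triangle\<close>)
qed

lemma lions_winning_strategy_relabel:
  assumes f: "inj f"
    and win: "lions_winning_strategy (f ` Y) (pull_dist f d) (f x1) (f x2) (f y0) G"
  shows "\<exists>G. lions_winning_strategy Y d x1 x2 y0 G"
proof
  define H where "H m = G (relabel f m)" for m
  have H: "H m \<in> paths (f ` Y) (pull_dist f d) (f x1) \<times> paths (f ` Y) (pull_dist f d) (f x2)"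
    "\<exists>t\<ge>0. fst (H m) t = f (m t) \<or> snd (H m) t = f (m t)" if "m \<in> paths Y d y0" for m
  proof -
    note rm = relabel_in_paths[OF f that]
    show "H m \<in> paths (f ` Y) (pull_dist f d) (f x1) \<times> paths (f ` Y) (pull_dist f d) (f x2)"
      using win rm unfolding lions_winning_strategy_def lions_strategy_def H_def by blast
    obtain t where "0 \<le> t" "fst (H m) t = relabel f m t \<or> snd (H m) t = relabel f m t"
      using win rm unfolding lions_winning_strategy_def H_def by blast
    then show "\<exists>t\<ge>0. fst (H m) t = f (m t) \<or> snd (H m) t = f (m t)"
      by (auto simp: relabel_apply)
  qed
  have H_agree: "agree_upto t (fst (H m)) (fst (H m')) \<and> agree_upto t (snd (H m)) (snd (H m'))"
    if "m \<in> paths Y d y0" "m' \<in> paths Y d y0" "0 \<le> t" "agree_upto t m m'" for m m' t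
    using win relabel_in_paths[OF f that(1)] relabel_in_paths[OF f that(2)] that(3)
      relabel_agree[OF that(4), of f]
    unfolding lions_winning_strategy_def lions_strategy_def H_def by blast
  show "lions_winning_strategy Y d x1 x2 y0
      (\<lambda>m. (relabel (inv f) (fst (H m)), relabel (inv f) (snd (H m))))"
    unfolding lions_winning_strategy_def lions_strategy_def
  proof (intro conjI ballI allI impI Pi_I)
    fix m assume m: "m \<in> paths Y d y0"
    show "(relabel (inv f) (fst (H m)), relabel (inv f) (snd (H m))) \<in> paths Y d x1 \<times> paths Y d x2"
      using H(1)[OF m] relabel_inv_in_paths[OF f] by (auto simp: mem_Times_iff)
    obtain t where "0 \<le> t" "fst (H m) t = f (m t) \<or> snd (H m) t = f (m t)"
      using H(2)[OF m] by blast
    then show "\<exists>t\<ge>0. fst (relabel (inv f) (fst (H m)), relabel (inv f) (snd (H m))) t = m t \<or>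
        snd (relabel (inv f) (fst (H m)), relabel (inv f) (snd (H m))) t = m t"
      using f by (auto simp: relabel_apply intro!: exI[of _ t])
  qed (use H_agree relabel_agree in \<open>simp; blast\<close>)+
qed

lemma man_winning_strategy_relabel:
  assumes f: "inj f"
    and win: "man_winning_strategy (f ` Y) (pull_dist f d) (f x1) (f x2) (f y0) F"
  shows "\<exists>F. man_winning_strategy Y d x1 x2 y0 F"
proof
  define H where "H l1 l2 = F (relabel f l1, relabel f l2)" for l1 l2
  note rel = relabel_in_paths[OF f]
  have H: "H l1 l2 \<in> paths (f ` Y) (pull_dist f d) (f y0)"
    if "l1 \<in> paths Y d x1" "l2 \<in> paths Y d x2" for l1 l2
    using win rel[OF that(1)] rel[OF that(2)]
    unfolding man_winning_strategy_def man_strategy_def H_def by blast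
  have H_free: "H l1 l2 t \<noteq> f (l1 t) \<and> H l1 l2 t \<noteq> f (l2 t)"
    if "l1 \<in> paths Y d x1" "l2 \<in> paths Y d x2" "0 \<le> t" for l1 l2 t
    using win rel[OF that(1)] rel[OF that(2)] that(3)
    unfolding man_winning_strategy_def H_def by (metis relabel_apply)
  have H_agree: "agree_upto t (H l1 l2) (H l1' l2')"
    if "l1 \<in> paths Y d x1" "l2 \<in> paths Y d x2" "l1' \<in> paths Y d x1" "l2' \<in> paths Y d x2"
      "0 \<le> t" "agree_upto t l1 l1'" "agree_upto t l2 l2'" for l1 l2 l1' l2' t
    using win rel[OF that(1)] rel[OF that(2)] rel[OF that(3)] rel[OF that(4)] that(5)
      relabel_agree[OF that(6), of f] relabel_agree[OF that(7), of f]
    unfolding man_winning_strategy_def man_strategy_def H_def by blast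
  show "man_winning_strategy Y d x1 x2 y0 (\<lambda>(l1, l2). relabel (inv f) (H l1 l2))"
    unfolding man_winning_strategy_def man_strategy_def
  proof (intro conjI ballI allI impI Pi_I)
    fix l assume "l \<in> paths Y d x1 \<times> paths Y d x2"
    then show "(case l of (l1, l2) \<Rightarrow> relabel (inv f) (H l1 l2)) \<in> paths Y d y0"
      using H relabel_inv_in_paths[OF f] by auto
  next
    fix l1 l2 and t :: real assume l: "l1 \<in> paths Y d x1" "l2 \<in> paths Y d x2" and t: "0 \<le> t"
    have "H l1 l2 t \<in> range f"
      using pathsD(1)[OF H[OF l] t] by blast
    then have "inv f (H l1 l2 t) = y \<Longrightarrow> H l1 l2 t = f y" for y
      by (metis f_inv_into_f)
    then show "(case (l1, l2) of (l1, l2) \<Rightarrow> relabel (inv f) (H l1 l2)) t \<noteq> l1 t"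
      "(case (l1, l2) of (l1, l2) \<Rightarrow> relabel (inv f) (H l1 l2)) t \<noteq> l2 t"
      using H_free[OF l t] by (auto simp: relabel_apply t)
  qed (use H_agree relabel_agree in \<open>simp; blast\<close>)
qed

text \<open>
  Any injection would do.
\<close>

definition encode :: "site \<Rightarrow> point" where
  "encode = (\<lambda>(k, p, x). {\<lambda>n. if n = 0 then real k else if n = 1 then p else x})"

lemma inj_encode: "inj encode"
proof (rule injI)
  fix a b assume "encode a = encode b"
  then have "(\<lambda>n::nat. if n = 0 then real (fst a) else if n = 1 then fst (snd a) else snd (snd a)) =
      (\<lambda>n. if n = 0 then real (fst b) else if n = 1 then fst (snd b) else snd (snd b))" (is "?g = ?h")
    by (simp add: encode_def split_beta)
  then have "?g n = ?h n" for n by (rule fun_cong)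
  from this[of 0] this[of 1] this[of 2] show "a = b"
    by (simp add: prod_eq_iff)
qed

theorem theorem13:
  shows "\<exists>(Y :: point set) (d :: point \<Rightarrow> point \<Rightarrow> real) x1 x2 y0.
    Metric_space Y d \<and> x1 \<in> Y \<and> x2 \<in> Y \<and> y0 \<in> Y \<and>
    \<not> (\<exists>G. lions_winning_strategy Y d x1 x2 y0 G) \<and>
    \<not> (\<exists>F. man_winning_strategy Y d x1 x2 y0 F)"
proof (intro exI conjI)
  show "Metric_space (encode ` arena) (pull_dist encode arena_dist)"
    by (rule Metric_space_relabel[OF inj_encode Metric_space_arena])
  show "encode (1, 0, 0) \<in> encode ` arena" "encode (0, -1, 0) \<in> encode ` arena"
      "encode (0, 0, 0) \<in> encode ` arena"
    by (auto simp: arena_def)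
  show "\<nexists>G. lions_winning_strategy (encode ` arena) (pull_dist encode arena_dist)
      (encode (1, 0, 0)) (encode (0, -1, 0)) (encode (0, 0, 0)) G"
    using lions_winning_strategy_relabel[OF inj_encode] lions_have_no_winning_strategy by blast
  show "\<nexists>F. man_winning_strategy (encode ` arena) (pull_dist encode arena_dist)
      (encode (1, 0, 0)) (encode (0, -1, 0)) (encode (0, 0, 0)) F"
    using man_winning_strategy_relabel[OF inj_encode] man_has_no_winning_strategy by blast
qed

end
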